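(* Let $\alpha,\beta\in\mathbb{R}$, $\tau>0$ and $E<0$. Suppose $\gamma(s)=(Q_1(s),Q_2(s),Q_3(s),P_1(s),P_2(s),P_3(s))^T$ is a solution, on an interval containing $[0,2\tau]$, of the Hamiltonian system with Hamiltonian $\Gamma$ (with energy parameter $E$) satisfying $$\gamma(0)=(0,\alpha,\alpha,\sqrt{2},-\beta,\beta)^T,\qquad \gamma(2\tau)=(\alpha,0,\alpha,\beta,-\sqrt{2},-\beta)^T.$$ Then $\gamma(s)$ extends to a $12\tau$-periodic solution (defined for all $s\in\mathbb{R}$) of the Hamiltonian system with Hamiltonian $\Gamma$.
   Context: For a fixed real parameter $E$ (the energy), the regularized Hamiltonian $\Gamma=\Gamma(Q_1,Q_2,Q_3,P_1,P_2,P_3)$ is $$\begin{aligned}\Gamma={}&P_1^2Q_2^2Q_3^2+Q_1^2P_2^2Q_3^2+Q_1^2Q_2^2P_3^2\\&-\frac{2Q_1^2Q_2^2Q_3^2}{\sqrt{Q_1^4+Q_2^4+Q_3^4}}-\frac{2Q_1^2Q_2^2Q_3^2}{\sqrt{Q_1^4+Q_2^4}}-\frac{2Q_1^2Q_2^2Q_3^2}{\sqrt{Q_1^4+Q_3^4}}-\frac{2Q_1^2Q_2^2Q_3^2}{\sqrt{Q_2^4+Q_3^4}}\\&-2Q_2^2Q_3^2-2Q_1^2Q_3^2-2Q_1^2Q_2^2-E\,Q_1^2Q_2^2Q_3^2,\end{aligned}$$ on the set of $(Q,P)\in\mathbb{R}^6$ for which at most one of $Q_1,Q_2,Q_3$ is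 zero. The associated Hamiltonian system is $\frac{dQ_i}{ds}=\frac{\partial\Gamma}{\partial P_i}$, $\frac{dP_i}{ds}=-\frac{\partial\Gamma}{\partial Q_i}$, $i=1,2,3$. (It is the Levi-Civita regularization, via $q_i=Q_i^2$, $p_i=P_i/(2Q_i)$, $dt/ds=Q_1^2Q_2^2Q_3^2$, of the Newtonian problem of eight unit masses at $(\pm q_1,\pm q_2,\pm q_3)$.) *)

theory Defs
  imports "HOL-Analysis.Analysis"
begin

definition partial_deriv :: "(real ^ 'n \<Rightarrow> real) \<Rightarrow> 'n \<Rightarrow> real ^ 'n \<Rightarrow> real" where
  "partial_deriv f i x = deriv (\<lambda>t. f (x + t *\<^sub>R axis i 1)) 0"

text \<open>
  Points of the phase space are pairs \<open>(Q, P)\<close>. A solution is required to stay in the domain \<open>D\<close>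
  of the Hamiltonian; at endpoints of \<open>I\<close> that belong to \<open>I\<close>, the derivatives are one-sided.
\<close>

definition hamiltonian_solution ::
  "((real ^ 'n) \<times> (real ^ 'n)) set \<Rightarrow> (real ^ 'n \<Rightarrow> real ^ 'n \<Rightarrow> real) \<Rightarrow>
    real set \<Rightarrow> (real \<Rightarrow> (real ^ 'n) \<times> (real ^ 'n)) \<Rightarrow> bool" where
  "hamiltonian_solution D H I \<gamma> \<longleftrightarrow>
    (\<forall>s\<in>I. \<gamma> s \<in> D \<and>
      (\<forall>i. ((\<lambda>u. fst (\<gamma> u) $ i) has_real_derivative
              partial_deriv (\<lambda>P. H (fst (\<gamma> s)) P) i (snd (\<gamma> s))) (at s within I) \<and>
           ((\<lambda>u. snd (\<gamma> u) $ i) has_real_derivative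
              - partial_deriv (\<lambda>Q. H Q (snd (\<gamma> s))) i (fst (\<gamma> s))) (at s within I)))"

definition phase_domain :: "((real ^ 3) \<times> (real ^ 3)) set" where
  "phase_domain = {(Q, P). card {i. Q $ i = 0} \<le> 1}"

definition Gam :: "real \<Rightarrow> real ^ 3 \<Rightarrow> real ^ 3 \<Rightarrow> real" where
  "Gam E Q P =
      (P$1)^2 * (Q$2)^2 * (Q$3)^2 + (Q$1)^2 * (P$2)^2 * (Q$3)^2 + (Q$1)^2 * (Q$2)^2 * (P$3)^2
    - 2 * (Q$1)^2 * (Q$2)^2 * (Q$3)^2 / sqrt ((Q$1)^4 + (Q$2)^4 + (Q$3)^4)
    - 2 * (Q$1)^2 * (Q$2)^2 * (Q$3)^2 / sqrt ((Q$1)^4 + (Q$2)^4)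
    - 2 * (Q$1)^2 * (Q$2)^2 * (Q$3)^2 / sqrt ((Q$1)^4 + (Q$3)^4)
    - 2 * (Q$1)^2 * (Q$2)^2 * (Q$3)^2 / sqrt ((Q$2)^4 + (Q$3)^4)
    - 2 * (Q$2)^2 * (Q$3)^2 - 2 * (Q$1)^2 * (Q$3)^2 - 2 * (Q$1)^2 * (Q$2)^2
    - E * (Q$1)^2 * (Q$2)^2 * (Q$3)^2"

end

theory Submission
  imports Defs "HOL-Library.Landau_Symbols"
begin

text \<open>
  The linear map \<open>A\<close> acting on both \<open>Q\<close> and \<open>P\<close> by \<open>(v\<^sub>1, v\<^sub>2, v\<^sub>3) \<mapsto> (v\<^sub>3, -v\<^sub>1, v\<^sub>2)\<close> is symplectic and
  preserves \<open>\<Gamma>\<close>, hence commutes with the Hamiltonian vector field. The boundary conditions say exactly that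
  \<open>\<gamma>(2\<tau>) = A \<gamma>(0)\<close>, so the arcs \<open>A\<^sup>k \<gamma>(s - 2k\<tau>)\<close> on \<open>[2k\<tau>, 2(k+1)\<tau>]\<close> fit together to a global solution,
  of period \<open>12\<tau>\<close> because \<open>A\<^sup>6 = 1\<close>. It agrees with \<open>\<gamma>\<close> on the whole interval of definition by
  uniqueness, the vector field being locally Lipschitz on the domain.
\<close>

section \<open>Local Lipschitz continuity in Landau notation\<close>

text \<open>The bound ranges over pairs near the diagonal point \<open>(x, x)\<close>, so one
  constant serves a whole neighbourhood of \<open>x\<close> and closure properties reduce to Landau
  calculus. Continuity is carried along to supply limits of factors.\<close>

definition lipschitz_near :: "('a::real_normed_vector \<Rightarrow> 'b::real_normed_vector) \<Rightarrow> 'a \<Rightarrow> bool" where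
  "lipschitz_near f x \<longleftrightarrow> isCont f x \<and>
    (\<lambda>p. norm (f (fst p) - f (snd p))) \<in> O[nhds (x, x)](\<lambda>p. norm (fst p - snd p))"

lemma lipschitz_near_bounded_linear:
  assumes "bounded_linear f"
  shows "lipschitz_near f x"
proof -
  interpret bounded_linear f by fact
  obtain K where K: "\<And>y. norm (f y) \<le> norm y * K" using bounded by blast
  have "(\<lambda>p. norm (f (fst p) - f (snd p))) \<in> O[nhds (x, x)](\<lambda>p. norm (fst p - snd p))"
    by (rule bigoI[where c = K], rule always_eventually)
      (use K in \<open>simp add: diff[symmetric] mult.commute\<close>)
  then show ?thesis
    unfolding lipschitz_near_def using assms linear_continuous_at by blast
qed

lemma lipschitz_near_const: "lipschitz_near (\<lambda>_. c) x"
  by (simp add: lipschitz_near_def)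

lemma tendsto_nhds_pair:
  assumes "isCont f x"
  shows "((\<lambda>p. f (fst p)) \<longlongrightarrow> f x) (nhds (x, x))" "((\<lambda>p. f (snd p)) \<longlongrightarrow> f x) (nhds (x, x))"
proof -
  have *: "(f \<longlongrightarrow> f x) (nhds x)" using assms by (simp add: continuous_at tendsto_at_iff_tendsto_nhds)
  have "filterlim fst (nhds x) (nhds (x, x))" "filterlim snd (nhds x) (nhds (x, x))"
    using tendsto_fst[OF filterlim_ident, of "(x, x)"] tendsto_snd[OF filterlim_ident, of "(x, x)"] by auto
  from filterlim_compose[OF * this(1)] filterlim_compose[OF * this(2)]
  show "((\<lambda>p. f (fst p)) \<longlongrightarrow> f x) (nhds (x, x))" "((\<lambda>p. f (snd p)) \<longlongrightarrow> f x) (nhds (x, x))"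
    by auto
qed

lemma tendsto_imp_bigo_1:
  fixes f :: "'a \<Rightarrow> real"
  assumes "(f \<longlongrightarrow> c) F"
  shows "f \<in> O[F](\<lambda>_. 1)"
  by (rule bigoI_tendsto[where c = c]) (use assms in auto)

lemma lipschitz_near_real_iff:
  fixes f :: "'a::real_normed_vector \<Rightarrow> real"
  shows "lipschitz_near f x \<longleftrightarrow> isCont f x \<and>
    (\<lambda>p. f (fst p) - f (snd p)) \<in> O[nhds (x, x)](\<lambda>p. norm (fst p - snd p))"
  unfolding lipschitz_near_def by simp

lemma lipschitz_near_add:
  fixes f g :: "'a::real_normed_vector \<Rightarrow> real"
  assumes "lipschitz_near f x" "lipschitz_near g x"
  shows "lipschitz_near (\<lambda>y. f y + g y) x"
  unfolding lipschitz_near_real_iff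
proof
  show "isCont (\<lambda>y. f y + g y) x"
    using assms by (auto simp: lipschitz_near_def intro!: continuous_intros)
  have "(\<lambda>p. (f (fst p) - f (snd p)) + (g (fst p) - g (snd p))) \<in> O[nhds (x, x)](\<lambda>p. norm (fst p - snd p))"
    by (rule sum_in_bigo) (use assms in \<open>auto simp: lipschitz_near_real_iff\<close>)
  then show "(\<lambda>p. f (fst p) + g (fst p) - (f (snd p) + g (snd p))) \<in> O[nhds (x, x)](\<lambda>p. norm (fst p - snd p))"
    by (simp add: add_diff_add)
qed

text \<open>With \<open>y\<close>, \<open>z\<close> the two components of a pair,
  \<open>f y * g y - f z * g z\<close> splits as
  \<open>f y * (g y - g z) + g z * (f y - f z)\<close>. The outer factors converge by continuity,
  hence are bounded.\<close>

lemma lipschitz_near_mult: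
  fixes f g :: "'a::real_normed_vector \<Rightarrow> real"
  assumes "lipschitz_near f x" "lipschitz_near g x"
  shows "lipschitz_near (\<lambda>y. f y * g y) x"
  unfolding lipschitz_near_real_iff
proof
  let ?d = "\<lambda>p::'a \<times> 'a. norm (fst p - snd p)"
  have c: "isCont f x" "isCont g x" using assms by (auto simp: lipschitz_near_def)
  then show "isCont (\<lambda>y. f y * g y) x" by (intro continuous_intros)
  have "(\<lambda>p. f (fst p) * (g (fst p) - g (snd p))) \<in> O[nhds (x, x)](\<lambda>p. 1 * ?d p)"
    using assms c by (intro landau_o.big.mult tendsto_imp_bigo_1[OF tendsto_nhds_pair(1)])
      (auto simp: lipschitz_near_real_iff)
  moreover have "(\<lambda>p. g (snd p) * (f (fst p) - f (snd p))) \<in> O[nhds (x, x)](\<lambda>p. 1 * ?d p)"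
    using assms c by (intro landau_o.big.mult tendsto_imp_bigo_1[OF tendsto_nhds_pair(2)])
      (auto simp: lipschitz_near_real_iff)
  ultimately have "(\<lambda>p. f (fst p) * (g (fst p) - g (snd p)) + g (snd p) * (f (fst p) - f (snd p)))
      \<in> O[nhds (x, x)](\<lambda>p. 1 * ?d p)"
    by (rule sum_in_bigo)
  then show "(\<lambda>p. f (fst p) * g (fst p) - f (snd p) * g (snd p)) \<in> O[nhds (x, x)](?d)"
    by (simp add: algebra_simps)
qed

lemma lipschitz_near_power:
  fixes f :: "'a::real_normed_vector \<Rightarrow> real"
  assumes "lipschitz_near f x"
  shows "lipschitz_near (\<lambda>y. f y ^ n) x"
  by (induction n) (auto intro: lipschitz_near_const lipschitz_near_mult assms)

text \<open>For \<open>u\<close>, \<open>v\<close> the roots of the two values,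
  \<open>1/u - 1/v = (v^2 - u^2) / (u * v * (u + v))\<close>. The factor \<open>?k\<close> has a
  finite limit because \<open>f x > 0\<close>; the identity itself holds only near the diagonal,
  where both values are positive.\<close>

lemma lipschitz_near_inverse_sqrt:
  fixes f :: "'a::real_normed_vector \<Rightarrow> real"
  assumes "lipschitz_near f x" and pos: "f x > 0"
  shows "lipschitz_near (\<lambda>y. inverse (sqrt (f y))) x"
  unfolding lipschitz_near_real_iff
proof
  let ?d = "\<lambda>p::'a \<times> 'a. norm (fst p - snd p)"
  let ?k = "\<lambda>p. inverse (sqrt (f (fst p)) * sqrt (f (snd p)) * (sqrt (f (fst p)) + sqrt (f (snd p))))"
  have c: "isCont f x" using assms by (auto simp: lipschitz_near_def)
  then show "isCont (\<lambda>y. inverse (sqrt (f y))) x" using pos by (intro continuous_intros) auto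
  note lims = tendsto_nhds_pair[OF c]
  have "(\<lambda>p. - (f (fst p) - f (snd p))) \<in> O[nhds (x, x)](?d)"
    using assms unfolding landau_o.big.uminus_in_iff by (simp add: lipschitz_near_real_iff)
  moreover have "?k \<in> O[nhds (x, x)](\<lambda>_. 1)"
    by (rule tendsto_imp_bigo_1[OF tendsto_inverse[OF tendsto_mult[OF tendsto_mult tendsto_add]]])
      (use lims[THEN tendsto_real_sqrt] pos in auto)
  ultimately have "(\<lambda>p. - (f (fst p) - f (snd p)) * ?k p) \<in> O[nhds (x, x)](\<lambda>p. ?d p * 1)"
    by (rule landau_o.big.mult)
  moreover have "eventually (\<lambda>p. f (fst p) > 0 \<and> f (snd p) > 0) (nhds (x, x))"
    using order_tendstoD(1)[OF lims(1) pos] order_tendstoD(1)[OF lims(2) pos]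
    by eventually_elim auto
  then have "eventually (\<lambda>p. - (f (fst p) - f (snd p)) * ?k p
      = inverse (sqrt (f (fst p))) - inverse (sqrt (f (snd p)))) (nhds (x, x))"
  proof eventually_elim
    case (elim p)
    define u where "u = sqrt (f (fst p))"
    define v where "v = sqrt (f (snd p))"
    have "u > 0" "v > 0" "f (fst p) = u\<^sup>2" "f (snd p) = v\<^sup>2" using elim by (auto simp: u_def v_def)
    moreover from this have "u + v \<noteq> 0" by linarith
    moreover have "- (u\<^sup>2 - v\<^sup>2) = (v - u) * (u + v)" by (simp add: power2_eq_square algebra_simps)
    moreover have "inverse u - inverse v = (v - u) * inverse (u * v)"
      using \<open>u > 0\<close> \<open>v > 0\<close> by (simp add: field_simps)
    ultimately have "- (u\<^sup>2 - v\<^sup>2) * inverse (u * v * (u + v)) = inverse u - inverse v"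
      by simp
    then show ?case using \<open>f (fst p) = u\<^sup>2\<close> \<open>f (snd p) = v\<^sup>2\<close> \<open>u > 0\<close> \<open>v > 0\<close> by simp
  qed
  ultimately show "(\<lambda>p. inverse (sqrt (f (fst p))) - inverse (sqrt (f (snd p)))) \<in> O[nhds (x, x)](?d)"
    by (subst (asm) landau_o.big.in_cong) auto
qed

lemma lipschitz_near_vec:
  fixes f :: "'a::real_normed_vector \<Rightarrow> real ^ 'n"
  assumes "\<And>i. lipschitz_near (\<lambda>y. f y $ i) x"
  shows "lipschitz_near f x"
  unfolding lipschitz_near_def
proof
  show "isCont f x"
    using assms unfolding lipschitz_near_def continuous_within by (intro vec_tendstoI) auto
  let ?d = "\<lambda>p::'a \<times> 'a. norm (fst p - snd p)"
  have "(\<lambda>p. \<Sum>i\<in>UNIV. \<bar>(f (fst p) - f (snd p)) $ i\<bar>) \<in> O[nhds (x, x)](?d)"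
    using assms by (intro big_sum_in_bigo) (simp add: lipschitz_near_def)
  moreover have "(\<lambda>p. norm (f (fst p) - f (snd p)))
      \<in> O[nhds (x, x)](\<lambda>p. \<Sum>i\<in>UNIV. \<bar>(f (fst p) - f (snd p)) $ i\<bar>)"
    by (rule bigoI[where c = 1], rule always_eventually)
      (auto intro!: order_trans[OF norm_le_l1_cart])
  ultimately show "(\<lambda>p. norm (f (fst p) - f (snd p))) \<in> O[nhds (x, x)](?d)"
    by (rule landau_o.big_trans[rotated])
qed

lemma lipschitz_near_Pair:
  assumes "lipschitz_near f x" "lipschitz_near g x"
  shows "lipschitz_near (\<lambda>y. (f y, g y)) x"
  unfolding lipschitz_near_def
proof
  show "isCont (\<lambda>y. (f y, g y)) x"
    using assms by (auto simp: lipschitz_near_def intro!: continuous_intros)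
  let ?S = "\<lambda>p. norm (f (fst p) - f (snd p)) + norm (g (fst p) - g (snd p))"
  have "?S \<in> O[nhds (x, x)](\<lambda>p. norm (fst p - snd p))"
    by (rule sum_in_bigo) (use assms in \<open>auto simp: lipschitz_near_def\<close>)
  moreover have "(\<lambda>p. norm ((f (fst p), g (fst p)) - (f (snd p), g (snd p)))) \<in> O[nhds (x, x)](?S)"
    by (rule bigoI[where c = 1], rule always_eventually) (auto intro!: order_trans[OF norm_Pair_le])
  ultimately show "(\<lambda>p. norm ((f (fst p), g (fst p)) - (f (snd p), g (snd p))))
      \<in> O[nhds (x, x)](\<lambda>p. norm (fst p - snd p))"
    by (rule landau_o.big_trans[rotated])
qed

lemma lipschitz_nearD:
  assumes "lipschitz_near f x"
  obtains e L where "e > 0" "L \<ge> 0"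
    "\<forall>y\<in>ball x e. \<forall>z\<in>ball x e. norm (f y - f z) \<le> L * norm (y - z)"
proof -
  obtain L where L: "L > 0" "eventually (\<lambda>p. norm (f (fst p) - f (snd p)) \<le> L * norm (fst p - snd p)) (nhds (x, x))"
    using assms unfolding lipschitz_near_def by (auto elim!: landau_o.bigE)
  then obtain e where e: "e > 0"
    "\<And>y z. dist (y, z) (x, x) < e \<Longrightarrow> norm (f y - f z) \<le> L * norm (y - z)"
    unfolding eventually_nhds_metric by auto
  show thesis
  \<comment> \<open>The distance in the product is at most the sum of the component distances, so
    half the radius for each component suffices.\<close>
  proof (rule that[of "e / 2" L])
    show "\<forall>y\<in>ball x (e / 2). \<forall>z\<in>ball x (e / 2). norm (f y - f z) \<le> L * norm (y - z)"
    proof (intro ballI e(2))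
      fix y z assume yz: "y \<in> ball x (e / 2)" "z \<in> ball x (e / 2)"
      have "dist (y, z) (x, x) \<le> dist y x + dist z x"
        unfolding dist_Pair_Pair by (rule sqrt_sum_squares_le_sum) auto
      then show "dist (y, z) (x, x) < e" using yz by (simp add: dist_commute)
    qed
  qed (use e(1) L(1) in auto)
qed

section \<open>Uniqueness for locally Lipschitz autonomous equations\<close>

text \<open>To the right of \<open>a\<close>, \<open>d s * exp (- K * s)\<close> is nonincreasing;
  to the left, \<open>d s * exp (K * s)\<close> is nondecreasing. Both vanish at \<open>a\<close>,
  which forces \<open>d b \<le> 0\<close>. The mean value theorem replaces a monotonicity
  argument.\<close>

lemma gronwall_zero:
  fixes d :: "real \<Rightarrow> real"
  assumes der: "\<And>s. s \<in> S \<Longrightarrow> (d has_real_derivative d' s) (at s within S)"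
    and bound: "\<And>s. s \<in> S \<Longrightarrow> \<bar>d' s\<bar> \<le> K * d s"
    and S: "is_interval S" "a \<in> S" "b \<in> S"
    and "d a = 0" "d b \<ge> 0"
  shows "d b = 0"
proof -
  consider "a = b" | "a < b" | "b < a" by linarith
  then show ?thesis
  proof cases
    case 2
    have sub: "{a..b} \<subseteq> S" using mem_is_interval_1_I[OF S] by auto
    let ?g = "\<lambda>s. d s * exp (- K * s)"
    have g: "(?g has_derivative (*) ((d' s - K * d s) * exp (- K * s))) (at s within {a..b})"
      if "a \<le> s" "s \<le> b" for s
    proof -
      have [derivative_intros]: "(d has_real_derivative d' s) (at s within {a..b})"
        by (rule DERIV_subset[OF der sub]) (use that sub in auto)
      have "(?g has_real_derivative (d' s - K * d s) * exp (- K * s)) (at s within {a..b})"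
        by (auto intro!: derivative_eq_intros simp: algebra_simps)
      then show ?thesis
        by (simp add: has_field_derivative_def)
    qed
    obtain s where s: "s \<in> {a<..<b}" "?g b - ?g a = (d' s - K * d s) * exp (- K * s) * (b - a)"
      using mvt_simple[OF 2 g] by blast
    have "s \<in> S" using s(1) sub by auto
    then have "d' s - K * d s \<le> 0" using bound[of s] by linarith
    then have "?g b - ?g a \<le> 0"
      unfolding s(2) using 2 by (intro mult_nonneg_nonpos mult_nonpos_nonneg) auto
    then have "d b \<le> 0" using \<open>d a = 0\<close> by (simp add: mult_le_0_iff)
    then show ?thesis using \<open>d b \<ge> 0\<close> by simp
  next
    case 3
    have sub: "{b..a} \<subseteq> S" using mem_is_interval_1_I[OF S(1,3,2)] by auto
    let ?g = "\<lambda>s. d s * exp (K * s)"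
    have g: "(?g has_derivative (*) ((d' s + K * d s) * exp (K * s))) (at s within {b..a})"
      if "b \<le> s" "s \<le> a" for s
    proof -
      have [derivative_intros]: "(d has_real_derivative d' s) (at s within {b..a})"
        by (rule DERIV_subset[OF der sub]) (use that sub in auto)
      have "(?g has_real_derivative (d' s + K * d s) * exp (K * s)) (at s within {b..a})"
        by (auto intro!: derivative_eq_intros simp: algebra_simps)
      then show ?thesis
        by (simp add: has_field_derivative_def)
    qed
    obtain s where s: "s \<in> {b<..<a}" "?g a - ?g b = (d' s + K * d s) * exp (K * s) * (a - b)"
      using mvt_simple[OF 3 g] by blast
    have "s \<in> S" using s(1) sub by auto
    then have "d' s + K * d s \<ge> 0" using bound[of s] by linarith
    then have "?g a - ?g b \<ge> 0"
      unfolding s(2) using 3 by (intro mult_nonneg_nonneg) auto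
    then have "d b \<le> 0" using \<open>d a = 0\<close> by (simp add: mult_le_0_iff)
    then show ?thesis using \<open>d b \<ge> 0\<close> by simp
  qed (use assms in simp)
qed

text \<open>Whether \<open>x s = y s\<close> holds is a locally constant property of
  \<open>s\<close>: agreement spreads by a Gronwall estimate, disagreement by continuity. On the
  connected set \<open>I\<close> it is therefore constant.\<close>

lemma ode_unique:
  fixes F :: "'a::real_inner \<Rightarrow> 'a"
  assumes I: "is_interval I" "a \<in> I"
    and lip: "\<And>s. s \<in> I \<Longrightarrow> lipschitz_near F (x s)"
    and x: "\<And>s. s \<in> I \<Longrightarrow> (x has_vector_derivative F (x s)) (at s within I)"
    and y: "\<And>s. s \<in> I \<Longrightarrow> (y has_vector_derivative F (y s)) (at s within I)"
    and "x a = y a" and "b \<in> I"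
  shows "x b = y b"
proof -
  have cx: "continuous_on I x" and cy: "continuous_on I y"
    using x y by (auto simp: continuous_on_eq_continuous_within intro: has_vector_derivative_continuous)
  have local: "eventually (\<lambda>s. x s = y s) (at s0 within I)" if s0: "s0 \<in> I" "x s0 = y s0" for s0
  proof -
    obtain e L where e: "e > 0" "L \<ge> 0"
      "\<forall>u\<in>ball (x s0) e. \<forall>v\<in>ball (x s0) e. norm (F u - F v) \<le> L * norm (u - v)"
      by (rule lipschitz_nearD[OF lip[OF s0(1)]])
    have "eventually (\<lambda>s. dist (x s) (x s0) < e) (at s0 within I)"
      "eventually (\<lambda>s. dist (y s) (x s0) < e) (at s0 within I)"
      using cx cy s0 e(1) by (auto simp: continuous_on_def intro!: tendstoD)
    then have "eventually (\<lambda>s. dist (x s) (x s0) < e \<and> dist (y s) (x s0) < e) (at s0 within I)"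
      by eventually_elim simp
    then obtain r where r: "r > 0"
      "\<And>s. s \<in> I \<Longrightarrow> s \<noteq> s0 \<Longrightarrow> dist s s0 < r \<Longrightarrow> dist (x s) (x s0) < e \<and> dist (y s) (x s0) < e"
      unfolding eventually_at by blast
    \<comment> \<open>On this neighbourhood of \<open>s0\<close> within \<open>I\<close> both
      solutions stay in the ball where \<open>F\<close> has Lipschitz constant
      \<open>L\<close>.\<close>
    define S where "S = I \<inter> ball s0 r"
    have "is_interval S" unfolding S_def by (intro is_interval_Int I is_interval_ball_real)
    have near: "dist (x s) (x s0) < e" "dist (y s) (x s0) < e" if "s \<in> S" for s
      using that r(2)[of s] s0 e(1) by (cases "s = s0"; auto simp: S_def dist_commute)+
    have "x s = y s" if "s \<in> S" for s
    proof -
      \<comment> \<open>The squared distance is differentiable even where the solutions meet.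
        Cauchy-Schwarz and the Lipschitz bound give
        \<open>\<bar>?d' t\<bar> \<le> 2 * L * ?d t\<close>.\<close>
      let ?d = "\<lambda>s. (x s - y s) \<bullet> (x s - y s)"
      let ?d' = "\<lambda>s. 2 * ((x s - y s) \<bullet> (F (x s) - F (y s)))"
      have "?d s = 0"
      proof (rule gronwall_zero[where S = S and a = s0 and d = ?d and d' = ?d' and K = "2 * L"])
        fix t assume t: "t \<in> S"
        have "(x has_vector_derivative F (x t)) (at t within S)"
          "(y has_vector_derivative F (y t)) (at t within S)"
          using t x[of t] y[of t] by (auto simp: S_def intro: has_vector_derivative_within_subset)
        then show "(?d has_real_derivative ?d' t) (at t within S)"
          unfolding has_vector_derivative_def has_field_derivative_def
          by (auto intro!: derivative_eq_intros simp: fun_eq_iff algebra_simps inner_commute)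
        have "\<bar>(x t - y t) \<bullet> (F (x t) - F (y t))\<bar> \<le> norm (x t - y t) * norm (F (x t) - F (y t))"
          by (rule Cauchy_Schwarz_ineq2)
        also have "\<dots> \<le> norm (x t - y t) * (L * norm (x t - y t))"
          using near[OF t] e(3) by (intro mult_left_mono) (auto simp: dist_commute)
        finally show "\<bar>?d' t\<bar> \<le> 2 * L * ?d t"
          by (simp add: dot_square_norm power2_eq_square algebra_simps abs_mult)
      qed (use \<open>is_interval S\<close> that s0 r in \<open>auto simp: S_def\<close>)
      then show ?thesis by simp
    qed
    then show ?thesis
      unfolding eventually_at using r(1) by (intro exI[of _ r]) (auto simp: S_def dist_commute)
  qed
  have "eventually (\<lambda>s. x s \<noteq> y s) (at s0 within I)" if "s0 \<in> I" "x s0 \<noteq> y s0" for s0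
  proof -
    have "((\<lambda>s. x s - y s) \<longlongrightarrow> x s0 - y s0) (at s0 within I)"
      using cx cy that by (auto simp: continuous_on_def intro!: tendsto_intros)
    from tendsto_imp_eventually_ne[OF this, of 0] that show ?thesis by simp
  qed
  with local have ev: "eventually (\<lambda>s. (x s = y s) = (x s0 = y s0)) (at s0 within I)" if "s0 \<in> I" for s0
    using that by (cases "x s0 = y s0") auto
  have "connected I" using I by (simp add: is_interval_connected)
  from connected_local_const[OF this \<open>a \<in> I\<close> \<open>b \<in> I\<close>, of "\<lambda>s. x s = y s"] ev
  show ?thesis using \<open>x a = y a\<close> by (auto simp: eq_commute)
qed

section \<open>Periodic extension of an arc by a symmetry of finite order\<close>

text \<open>The time \<open>s\<close> is separate from the set \<open>I\<close>, so that one-sided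
  statements at a junction of two arcs can be combined into a two-sided one.\<close>

definition solves_at :: "'a set \<Rightarrow> ('a::real_normed_vector \<Rightarrow> 'a) \<Rightarrow> (real \<Rightarrow> 'a) \<Rightarrow> real \<Rightarrow> real set \<Rightarrow> bool" where
  "solves_at D F x s I \<longleftrightarrow> x s \<in> D \<and> (x has_vector_derivative F (x s)) (at s within I)"

text \<open>On the shifted set \<open>x u = A (x (u - c))\<close>, so the chain rule gives the
  derivative \<open>A (F (x s))\<close>, which equals \<open>F (A (x s))\<close> by
  equivariance.\<close>

lemma solves_at_shift:
  assumes A: "bounded_linear A" "\<And>z. z \<in> D \<Longrightarrow> A z \<in> D \<and> F (A z) = A (F z)"
    and shift: "\<And>u. u \<in> I \<Longrightarrow> x (u + c) = A (x u)"
    and x: "solves_at D F x s I" and "s \<in> I"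
  shows "solves_at D F x (s + c) ((\<lambda>u. u + c) ` I)"
proof -
  have "x s \<in> D" and xd: "(x has_vector_derivative F (x s)) (at s within I)"
    using x by (auto simp: solves_at_def)
  have "((\<lambda>u. u - c) has_vector_derivative 1) (at (s + c) within (\<lambda>u. u + c) ` I)"
    by (auto intro!: derivative_eq_intros)
  moreover have "(\<lambda>u. u - c) ` (\<lambda>u. u + c) ` I = I" by (simp add: image_image)
  ultimately have "((x \<circ> (\<lambda>u. u - c)) has_vector_derivative 1 *\<^sub>R F (x s)) (at (s + c) within (\<lambda>u. u + c) ` I)"
    using xd by (intro vector_diff_chain_within) auto
  from bounded_linear.has_vector_derivative[OF A(1) this]
  have "((\<lambda>u. A (x (u - c))) has_vector_derivative F (x (s + c))) (at (s + c) within (\<lambda>u. u + c) ` I)"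
    using A(2)[OF \<open>x s \<in> D\<close>] shift[OF \<open>s \<in> I\<close>] by (simp add: o_def)
  then have "(x has_vector_derivative F (x (s + c))) (at (s + c) within (\<lambda>u. u + c) ` I)"
    by (rule has_vector_derivative_transform[rotated 2]) (use \<open>s \<in> I\<close> shift in auto)
  then show ?thesis
    using A(2)[OF \<open>x s \<in> D\<close>] shift[OF \<open>s \<in> I\<close>] by (simp add: solves_at_def)
qed

lemma has_vector_derivative_Un:
  assumes "(f has_vector_derivative f') (at x within S)" "(f has_vector_derivative f') (at x within T)"
  shows "(f has_vector_derivative f') (at x within (S \<union> T))"
  using assms unfolding has_vector_derivative_def has_derivative_within Lim_within_Un by blast

text \<open>Reducing the exponent modulo \<open>n\<close> gives meaning to \<open>A\<close> to the
  power \<open>k\<close> for every integer \<open>k\<close>, negative ones included. Where the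
  residue wraps from \<open>n - 1\<close> to 0, \<open>A ^^ n = id\<close> is used.\<close>

lemma funpow_mod_Suc:
  assumes "n > 0" and "\<And>z. (A ^^ n) z = z"
  shows "(A ^^ nat ((k + 1) mod int n)) z = A ((A ^^ nat (k mod int n)) z)"
proof (cases "k mod int n + 1 = int n")
  case True
  then have "(k + 1) mod int n = 0" by (metis mod_add_left_eq mod_self)
  moreover have "Suc (nat (k mod int n)) = n" using True assms(1) by (simp add: nat_eq_iff Suc_as_int)
  ultimately show ?thesis using assms(2)[of z] by (metis funpow.simps(2) comp_apply funpow_0 nat_0)
next
  case False
  have pos: "0 \<le> k mod int n" "k mod int n < int n" using assms(1) by auto
  have "(k + 1) mod int n = (k mod int n + 1) mod int n" by (simp add: mod_simps)
  also have "\<dots> = k mod int n + 1"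
    using False pos by (intro mod_pos_pos_trivial) linarith+
  finally have "(k + 1) mod int n = k mod int n + 1" .
  then show ?thesis using pos by (simp add: nat_add_distrib)
qed

text \<open>The concatenated arcs satisfy \<open>x (s + T) = A (x s)\<close>. Hence it is enough to
  verify the equation on \<open>[0, T)\<close>; shifts by \<open>T\<close> in both directions carry
  it to all times.\<close>

lemma periodic_extension:
  fixes F A :: "'a::real_normed_vector \<Rightarrow> 'a"
  assumes "T > 0" "n > 0"
    and A: "bounded_linear A" "\<And>z. z \<in> D \<Longrightarrow> A z \<in> D \<and> F (A z) = A (F z)" "\<And>z. (A ^^ n) z = z"
    and g: "\<And>s. s \<in> {0..T} \<Longrightarrow> solves_at D F g s {0..T}" and gT: "g T = A (g 0)"
  shows "\<exists>x. (\<forall>s. solves_at D F x s UNIV) \<and> (\<forall>s. x (s + real n * T) = x s) \<and> x 0 = g 0"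
proof -
  \<comment> \<open>The floor counts the half-open interval containing \<open>s\<close>; at a
    junction it selects the later arc.\<close>
  define x where "x s = (A ^^ nat (\<lfloor>s / T\<rfloor> mod int n)) (g (s - of_int \<lfloor>s / T\<rfloor> * T))" for s
  have step: "x (s + T) = A (x s)" for s
  proof -
    have "\<lfloor>(s + T) / T\<rfloor> = \<lfloor>s / T\<rfloor> + 1" using \<open>T > 0\<close> by (simp add: add_divide_distrib)
    then show ?thesis
      unfolding x_def by (simp only: funpow_mod_Suc[OF \<open>n > 0\<close> A(3)]) (simp add: algebra_simps)
  qed
  have steps: "x (s + real m * T) = (A ^^ m) (x s)" for s m
  proof (induction m)
    case (Suc m)
    have "x (s + real (Suc m) * T) = x (s + real m * T + T)" by (simp add: algebra_simps)
    then show ?case by (simp only: step Suc) simp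
  qed simp
  have period: "x (s + real n * T) = x s" for s
    by (simp add: steps A(3))
  have "x s = g s" if "0 \<le> s" "s < T" for s
  proof -
    have "\<lfloor>s / T\<rfloor> = 0" using that by (simp add: floor_eq_iff)
    then show ?thesis by (simp add: x_def)
  qed
  \<comment> \<open>At \<open>T\<close> the floor is already 1, so agreement with \<open>g\<close>
    there rests on the matching condition \<open>gT\<close>.\<close>
  moreover from this[of 0] have "x T = g T" using step[of 0] gT \<open>T > 0\<close> by simp
  ultimately have xg: "x s = g s" if "s \<in> {0..T}" for s
    using that by (cases "s = T") auto
  have base: "solves_at D F x s {0..T}" if "s \<in> {0..T}" for s
    using g[OF that] xg that unfolding solves_at_def
    by (auto intro: has_vector_derivative_transform)
  have An: "bounded_linear (A ^^ m) \<and> (\<forall>z\<in>D. (A ^^ m) z \<in> D \<and> F ((A ^^ m) z) = (A ^^ m) (F z))" for m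
  proof (induction m)
    case (Suc m)
    then show ?case using A(1,2) bounded_linear_compose[of A "A ^^ m"] by (auto simp: o_def)
  qed (auto simp: id_def)
  have fwd: "solves_at D F x (s + T) UNIV" if "solves_at D F x s UNIV" for s
    using solves_at_shift[OF A(1,2) step that] by (simp add: surj_plus_right)
  \<comment> \<open>\<open>A ^^ (n - 1)\<close> acts as the inverse of \<open>A\<close>, so a
    backward shift is also a linear symmetry of the equation.\<close>
  have unstep: "x (u - T) = (A ^^ (n - 1)) (x u)" for u
  proof -
    have "x (u - T) = x (u - T + real n * T)" by (simp only: period)
    also have "u - T + real n * T = u + real (n - 1) * T"
      using \<open>n > 0\<close> by (simp add: of_nat_diff algebra_simps)
    finally show ?thesis by (simp only: steps)
  qed
  \<comment> \<open>The set \<open>I\<close> is left general because the closed arc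
    \<open>{0..T}\<close> must be shifted back as well as the whole line.\<close>
  have bwd: "solves_at D F x (s - T) ((\<lambda>u. u - T) ` I)" if "solves_at D F x s I" "s \<in> I" for s I
    using solves_at_shift[of "A ^^ (n - 1)" D F I x "- T" s] An[of "n - 1"] that unstep by simp
  \<comment> \<open>At 0 the right derivative comes from the arc itself and the left derivative from
    its end at \<open>T\<close>, shifted back by \<open>T\<close>.\<close>
  have start: "solves_at D F x s UNIV" if "0 \<le> s" "s < T" for s
  proof (cases "s = 0")
    case True
    have "solves_at D F x 0 ({-T..0} \<union> {0..T})"
      using bwd[OF base[of T]] base[of 0] \<open>T > 0\<close>
      by (auto simp: solves_at_def image_diff_atLeastAtMost intro: has_vector_derivative_Un)
    moreover have "{-T..0} \<union> {0..T} = {-T..T}" using \<open>T > 0\<close> by auto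
    ultimately show ?thesis using \<open>T > 0\<close> True by (simp add: solves_at_def at_within_Icc_at)
  next
    case False
    then show ?thesis using base[of s] that by (simp add: solves_at_def at_within_Icc_at)
  qed
  have "solves_at D F x (s + of_int k * T) UNIV" if "0 \<le> s" "s < T" for s k
  proof (induction k rule: int_induct[where k = 0])
    case base
    then show ?case using start[OF that] by simp
  next
    case (step1 i)
    from fwd[OF step1(2)] show ?case by (simp add: algebra_simps)
  next
    case (step2 i)
    from bwd[OF step2(2)] show ?case by (simp add: algebra_simps)
  qed
  moreover have "s - of_int \<lfloor>s / T\<rfloor> * T \<ge> 0" "s - of_int \<lfloor>s / T\<rfloor> * T < T" for s
    using floor_divide_lower[OF \<open>T > 0\<close>, of s] floor_divide_upper[OF \<open>T > 0\<close>, of s]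
    by (auto simp: algebra_simps)
  ultimately have "solves_at D F x s UNIV" for s
    by (metis diff_add_cancel)
  then show ?thesis using period xg[of 0] \<open>T > 0\<close> by (intro exI[of _ x]) auto
qed

section \<open>The Hamiltonian vector field in explicit form\<close>

text \<open>
  \<open>\<Gamma>\<close> is invariant under simultaneous permutations of \<open>Q\<close> and \<open>P\<close>, so a single expression describes all
  three derivatives: \<open>a\<close> is the coordinate of differentiation, \<open>b, c\<close> are the other two coordinates, and
  \<open>p, q, r\<close> are the momenta conjugate to \<open>a, b, c\<close>.
\<close>

definition minus_dGam :: "real \<Rightarrow> real \<Rightarrow> real \<Rightarrow> real \<Rightarrow> real \<Rightarrow> real \<Rightarrow> real" where
  "minus_dGam E a b c q r =
    4 * a * b^2 * c^2 * ((b^4 + c^4) * inverse (sqrt (a^4 + (b^4 + c^4)))^3 + b^4 * inverse (sqrt (a^4 + b^4))^3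
      + c^4 * inverse (sqrt (a^4 + c^4))^3 + inverse (sqrt (b^4 + c^4)))
    + 4 * a * (b^2 + c^2) + 2 * E * a * b^2 * c^2 + - 2 * a * (q^2 * c^2 + r^2 * b^2)"

definition Gam_field :: "real \<Rightarrow> (real ^ 3) \<times> (real ^ 3) \<Rightarrow> (real ^ 3) \<times> (real ^ 3)" where
  "Gam_field E z = (let Q = fst z; P = snd z in
    (vector [2 * P$1 * (Q$2)^2 * (Q$3)^2, 2 * P$2 * (Q$1)^2 * (Q$3)^2, 2 * P$3 * (Q$1)^2 * (Q$2)^2],
     vector [minus_dGam E (Q$1) (Q$2) (Q$3) (P$2) (P$3),
             minus_dGam E (Q$2) (Q$1) (Q$3) (P$1) (P$3),
             minus_dGam E (Q$3) (Q$1) (Q$2) (P$1) (P$2)]))"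

lemma minus_dGam_odd: "minus_dGam E (- a) b c q r = - minus_dGam E a b c q r"
  by (simp add: minus_dGam_def algebra_simps)

lemma minus_dGam_even:
  "minus_dGam E a (- b) c (- q) r = minus_dGam E a b c q r"
  "minus_dGam E a b (- c) q (- r) = minus_dGam E a b c q r"
  by (simp_all add: minus_dGam_def)

lemma minus_dGam_swap: "minus_dGam E a b c q r = minus_dGam E a c b r q"
  by (simp add: minus_dGam_def ac_simps)

text \<open>A set has at most one element exactly when any two of its elements agree. The pairwise
  form is what makes the radicands in \<open>Gam\<close> positive.\<close>

lemma mem_phase_domain_iff:
  "z \<in> phase_domain \<longleftrightarrow>
    (fst z $ 1 \<noteq> 0 \<or> fst z $ 2 \<noteq> 0) \<and> (fst z $ 1 \<noteq> 0 \<or> fst z $ 3 \<noteq> 0) \<and> (fst z $ 2 \<noteq> 0 \<or> fst z $ 3 \<noteq> 0)"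
proof -
  have "z \<in> phase_domain \<longleftrightarrow> (\<forall>i j. fst z $ i = 0 \<longrightarrow> fst z $ j = 0 \<longrightarrow> i = j)"
    unfolding phase_domain_def One_nat_def
    by (cases z) (auto simp: card_le_Suc0_iff_eq)
  then show ?thesis by (auto simp: forall_3)
qed

lemma sum_fourth_powers_pos:
  fixes a b :: real
  assumes "a \<noteq> 0 \<or> b \<noteq> 0"
  shows "a^4 + b^4 > 0"
proof -
  have "a^4 \<ge> 0" "b^4 \<ge> 0" "a \<noteq> 0 \<Longrightarrow> a^4 \<noteq> 0" "b \<noteq> 0 \<Longrightarrow> b^4 \<noteq> 0"
    by (auto simp: zero_le_even_power)
  then show ?thesis using assms by linarith
qed

text \<open>Three of the interaction terms have this form in the differentiated coordinate. With
  \<open>S^2 = a^4 + m\<close>, the quotient rule leaves \<open>2 * a * (S^2 - a^4) / S^3\<close>,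
  and the difference is \<open>m\<close>.\<close>

lemma DERIV_square_over_sqrt:
  fixes a m :: real
  assumes "a^4 + m > 0"
  shows "((\<lambda>t. (a + t)^2 / sqrt ((a + t)^4 + m)) has_real_derivative
    2 * a * m * inverse (sqrt (a^4 + m))^3) (at 0)"
proof -
  define S where "S = sqrt (a^4 + m)"
  have S: "S > 0" "S * S = a^4 + m" using assms by (auto simp: S_def)
  have "((\<lambda>t. (a + t)^2 / sqrt ((a + t)^4 + m)) has_real_derivative
    (2 * a * S - a^2 * (4 * a^3 * (inverse S / 2))) / (S * S)) (at 0)"
    using assms unfolding S_def by (auto intro!: derivative_eq_intros)
  also have "(2 * a * S - a^2 * (4 * a^3 * (inverse S / 2))) / (S * S) = 2 * a * (S * S - a^4) * inverse S ^ 3"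
    using S(1) by (simp add: field_simps power_numeral_reduce)
  finally show ?thesis by (simp add: S(2)) (simp add: S_def)
qed

text \<open>\<open>Gam\<close> regrouped around one distinguished coordinate \<open>a\<close>, with
  the interaction terms as quotients that can be differentiated one at a time.\<close>

definition Gam_shape :: "real \<Rightarrow> real \<Rightarrow> real \<Rightarrow> real \<Rightarrow> real \<Rightarrow> real \<Rightarrow> real \<Rightarrow> real" where
  "Gam_shape E a b c p q r = p^2 * b^2 * c^2 + a^2 * (q^2 * c^2 + r^2 * b^2)
    - 2 * b^2 * c^2 * (a^2 / sqrt (a^4 + (b^4 + c^4)) + a^2 / sqrt (a^4 + b^4)
      + a^2 / sqrt (a^4 + c^4) + a^2 / sqrt (b^4 + c^4))
    - 2 * b^2 * c^2 - 2 * a^2 * (b^2 + c^2) - E * a^2 * b^2 * c^2"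

lemma Gam_eq_Gam_shape:
  "Gam E Q P = Gam_shape E (Q$1) (Q$2) (Q$3) (P$1) (P$2) (P$3)"
  "Gam E Q P = Gam_shape E (Q$2) (Q$1) (Q$3) (P$2) (P$1) (P$3)"
  "Gam E Q P = Gam_shape E (Q$3) (Q$1) (Q$2) (P$3) (P$1) (P$2)"
  by (simp_all add: Gam_def Gam_shape_def algebra_simps)

lemma DERIV_Gam_shape:
  assumes "a \<noteq> 0 \<or> b \<noteq> 0" "a \<noteq> 0 \<or> c \<noteq> 0" "b \<noteq> 0 \<or> c \<noteq> 0"
  shows "((\<lambda>t. Gam_shape E (a + t) b c p q r) has_real_derivative - minus_dGam E a b c q r) (at 0)"
proof -
  have bc: "b^4 + c^4 > 0" using sum_fourth_powers_pos assms by blast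
  have "a^4 \<ge> 0" by (simp add: zero_le_even_power)
  then have abc: "a^4 + (b^4 + c^4) > 0" using bc by linarith
  note quot = DERIV_square_over_sqrt[OF abc]
    DERIV_square_over_sqrt[OF sum_fourth_powers_pos[OF assms(1)]]
    DERIV_square_over_sqrt[OF sum_fourth_powers_pos[OF assms(2)]]
  have sq: "((\<lambda>t. (a + t)^2) has_real_derivative 2 * a) (at 0)"
    by (auto intro!: derivative_eq_intros)
  show ?thesis
    unfolding Gam_shape_def
    \<comment> \<open>The rules follow the shape of the expression and treat each quotient as a
      unit; only the resulting sum is compared with \<open>minus_dGam\<close>.\<close>
    by (rule DERIV_cong, (rule quot sq DERIV_const DERIV_add DERIV_diff DERIV_cmult_right DERIV_cmult DERIV_cdivide)+)
      (simp add: minus_dGam_def algebra_simps divide_inverse)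
qed

lemma partial_deriv_Gam_P:
  "partial_deriv (Gam E Q) 1 P = 2 * P$1 * (Q$2)^2 * (Q$3)^2"
  "partial_deriv (Gam E Q) 2 P = 2 * P$2 * (Q$1)^2 * (Q$3)^2"
  "partial_deriv (Gam E Q) 3 P = 2 * P$3 * (Q$1)^2 * (Q$2)^2"
  unfolding partial_deriv_def Gam_def axis_def
  by (rule DERIV_imp_deriv, auto intro!: derivative_eq_intros)+

lemma partial_deriv_Gam_Q:
  assumes "(Q, P) \<in> phase_domain"
  shows "partial_deriv (\<lambda>Q. Gam E Q P) 1 Q = - minus_dGam E (Q$1) (Q$2) (Q$3) (P$2) (P$3)"
    "partial_deriv (\<lambda>Q. Gam E Q P) 2 Q = - minus_dGam E (Q$2) (Q$1) (Q$3) (P$1) (P$3)"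
    "partial_deriv (\<lambda>Q. Gam E Q P) 3 Q = - minus_dGam E (Q$3) (Q$1) (Q$2) (P$1) (P$2)"
proof -
  have nz: "Q$1 \<noteq> 0 \<or> Q$2 \<noteq> 0" "Q$1 \<noteq> 0 \<or> Q$3 \<noteq> 0" "Q$2 \<noteq> 0 \<or> Q$3 \<noteq> 0"
    using assms unfolding mem_phase_domain_iff by auto
  \<comment> \<open>Items 4 to 6 are the same disjunctions reversed. Each selection below puts the
    differentiated coordinate first.\<close>
  note nz' = nz nz[THEN disj_commute[THEN iffD1]]
  show "partial_deriv (\<lambda>Q. Gam E Q P) 1 Q = - minus_dGam E (Q$1) (Q$2) (Q$3) (P$2) (P$3)"
    using DERIV_imp_deriv[OF DERIV_Gam_shape[OF nz'(1,2,3)]]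
    by (simp add: partial_deriv_def Gam_eq_Gam_shape(1) axis_def)
  show "partial_deriv (\<lambda>Q. Gam E Q P) 2 Q = - minus_dGam E (Q$2) (Q$1) (Q$3) (P$1) (P$3)"
    using DERIV_imp_deriv[OF DERIV_Gam_shape[OF nz'(4,3,2)]]
    by (simp add: partial_deriv_def Gam_eq_Gam_shape(2) axis_def)
  show "partial_deriv (\<lambda>Q. Gam E Q P) 3 Q = - minus_dGam E (Q$3) (Q$1) (Q$2) (P$1) (P$2)"
    using DERIV_imp_deriv[OF DERIV_Gam_shape[OF nz'(5,6,1)]]
    by (simp add: partial_deriv_def Gam_eq_Gam_shape(3) axis_def)
qed

section \<open>Reduction to a vector equation with locally Lipschitz right-hand side\<close>

lemma has_vector_derivative_vec_iff:
  fixes f :: "real \<Rightarrow> real ^ 'n"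
  shows "(f has_vector_derivative f') (at s within I) \<longleftrightarrow>
    (\<forall>i. ((\<lambda>u. f u $ i) has_real_derivative f' $ i) (at s within I))"
  unfolding has_vector_derivative_def has_real_derivative_iff_has_vector_derivative
    has_derivative_componentwise_within[of f] Basis_vec_def
  by (simp add: inner_axis)

text \<open>Derivatives of pairs and vectors split into coordinates, where the explicit partial
  derivatives apply. Those in \<open>Q\<close> are computed only on \<open>phase_domain\<close>,
  which both sides require.\<close>

lemma hamiltonian_solution_Gam_iff:
  "hamiltonian_solution phase_domain (Gam E) I x \<longleftrightarrow>
    (\<forall>s\<in>I. solves_at phase_domain (Gam_field E) x s I)"
proof -
  have "((\<forall>i. ((\<lambda>u. fst (x u) $ i) has_real_derivative
              partial_deriv (\<lambda>P. Gam E (fst (x s)) P) i (snd (x s))) (at s within I) \<and>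
           ((\<lambda>u. snd (x u) $ i) has_real_derivative
              - partial_deriv (\<lambda>Q. Gam E Q (snd (x s))) i (fst (x s))) (at s within I))
      \<longleftrightarrow> (x has_vector_derivative Gam_field E (x s)) (at s within I))"
    if "x s \<in> phase_domain" for s
  proof -
    have *: "(fst (x s), snd (x s)) \<in> phase_domain" using that by simp
    have "(x has_vector_derivative Gam_field E (x s)) (at s within I) \<longleftrightarrow>
      ((\<lambda>u. fst (x u)) has_vector_derivative fst (Gam_field E (x s))) (at s within I) \<and>
      ((\<lambda>u. snd (x u)) has_vector_derivative snd (Gam_field E (x s))) (at s within I)"
      using has_vector_derivative_Pair[of "\<lambda>u. fst (x u)" "fst (Gam_field E (x s))" s I
          "\<lambda>u. snd (x u)" "snd (Gam_field E (x s))"]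
      by (auto intro: bounded_linear.has_vector_derivative bounded_linear_fst bounded_linear_snd)
    then show ?thesis
      unfolding has_vector_derivative_vec_iff forall_3
      by (auto simp: partial_deriv_Gam_P partial_deriv_Gam_Q[OF *] Gam_field_def Let_def)
  qed
  then show ?thesis unfolding hamiltonian_solution_def solves_at_def by blast
qed

lemma lipschitz_near_vector_3:
  fixes f g h :: "'a::real_normed_vector \<Rightarrow> real"
  assumes "lipschitz_near f x" "lipschitz_near g x" "lipschitz_near h x"
  shows "lipschitz_near (\<lambda>y. vector [f y, g y, h y] :: real ^ 3) x"
proof (rule lipschitz_near_vec)
  fix i :: 3
  show "lipschitz_near (\<lambda>y. (vector [f y, g y, h y] :: real ^ 3) $ i) x"
    using assms exhaust_3[of i] by auto
qed

text \<open>\<open>minus_dGam\<close> is composed of sums, products, powers and reciprocal square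
  roots, its subtraction being written as a sum with coefficient \<open>- 2\<close>. All radicands
  are positive because no two coordinates vanish together.\<close>

lemma lipschitz_near_minus_dGam:
  assumes "lipschitz_near a x" "lipschitz_near b x" "lipschitz_near c x" "lipschitz_near q x" "lipschitz_near r x"
    and nz: "a x \<noteq> 0 \<or> b x \<noteq> 0" "a x \<noteq> 0 \<or> c x \<noteq> 0" "b x \<noteq> 0 \<or> c x \<noteq> 0"
  shows "lipschitz_near (\<lambda>y. minus_dGam E (a y) (b y) (c y) (q y) (r y)) x"
proof -
  have "b x^4 + c x^4 > 0" "a x^4 + b x^4 > 0" "a x^4 + c x^4 > 0"
    using sum_fourth_powers_pos nz by blast+
  moreover have "a x^4 \<ge> 0" by (simp add: zero_le_even_power)
  ultimately show ?thesis
    unfolding minus_dGam_def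
    by (intro lipschitz_near_add lipschitz_near_mult lipschitz_near_power lipschitz_near_inverse_sqrt
        lipschitz_near_const assms) auto
qed

lemma lipschitz_near_Gam_field:
  assumes "z \<in> phase_domain"
  shows "lipschitz_near (Gam_field E) z"
proof -
  note comp = lipschitz_near_bounded_linear[OF bounded_linear_compose[OF bounded_linear_vec_nth bounded_linear_fst]]
    lipschitz_near_bounded_linear[OF bounded_linear_compose[OF bounded_linear_vec_nth bounded_linear_snd]]
  show ?thesis
    unfolding Gam_field_def[abs_def] Let_def
    using assms unfolding mem_phase_domain_iff
    by (intro lipschitz_near_Pair lipschitz_near_vector_3 lipschitz_near_minus_dGam
        lipschitz_near_mult lipschitz_near_power lipschitz_near_const comp) auto
qed

section \<open>The symmetry of order six and the periodic solution\<close>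

text \<open>
  The sign makes the third power equal to \<open>-1\<close>, so the map has order 6, and \<open>12 \<tau> = 6 \<cdot> 2 \<tau>\<close>.
\<close>

definition rotoreflection :: "real ^ 3 \<Rightarrow> real ^ 3" where
  "rotoreflection v = vector [v$3, - v$1, v$2]"

lemma rotoreflection_nth [simp]:
  "rotoreflection v $ 1 = v$3" "rotoreflection v $ 2 = - v$1" "rotoreflection v $ 3 = v$2"
  by (simp_all add: rotoreflection_def)

lemma bounded_linear_rotoreflection: "bounded_linear rotoreflection"
  by (intro linear_conv_bounded_linear[THEN iffD1] linearI) (simp_all add: vec_eq_iff forall_3)

text \<open>The permutation of coordinates is absorbed by \<open>minus_dGam_swap\<close>. The sign
  change is absorbed by oddness in the differentiated coordinate and evenness in each other
  coordinate taken with its momentum.\<close>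

lemma Gam_field_rotoreflection:
  "Gam_field E (map_prod rotoreflection rotoreflection z) = map_prod rotoreflection rotoreflection (Gam_field E z)"
  by (simp add: Gam_field_def Let_def vec_eq_iff forall_3 prod_eq_iff minus_dGam_odd minus_dGam_even
      minus_dGam_swap algebra_simps)

theorem lemma1:
  fixes \<alpha> \<beta> \<tau> E :: real
    and I :: "real set"
    and \<gamma> :: "real \<Rightarrow> (real ^ 3) \<times> (real ^ 3)"
  assumes "\<tau> > 0" and "E < 0"
    and "is_interval I" and "{0..2 * \<tau>} \<subseteq> I"
    and "hamiltonian_solution phase_domain (Gam E) I \<gamma>"
    and "\<gamma> 0 = (vector [0, \<alpha>, \<alpha>], vector [sqrt 2, - \<beta>, \<beta>])"
    and "\<gamma> (2 * \<tau>) = (vector [\<alpha>, 0, \<alpha>], vector [\<beta>, - sqrt 2, - \<beta>])"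
  shows "\<exists>\<delta> :: real \<Rightarrow> (real ^ 3) \<times> (real ^ 3).
           hamiltonian_solution phase_domain (Gam E) UNIV \<delta> \<and>
           (\<forall>s. \<delta> (s + 12 * \<tau>) = \<delta> s) \<and>
           (\<forall>s\<in>I. \<delta> s = \<gamma> s)"
proof -
  let ?A = "map_prod rotoreflection rotoreflection"
  let ?F = "Gam_field E"
  have sol: "solves_at phase_domain ?F \<gamma> s I" if "s \<in> I" for s
    using assms(5) that by (simp add: hamiltonian_solution_Gam_iff)
  have lin: "bounded_linear ?A"
    unfolding map_prod_def case_prod_beta
    by (intro bounded_linear_Pair bounded_linear_compose[OF bounded_linear_rotoreflection]
        bounded_linear_fst bounded_linear_snd)
  have equiv: "?A z \<in> phase_domain \<and> ?F (?A z) = ?A (?F z)" if "z \<in> phase_domain" for z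
    using that by (auto simp: mem_phase_domain_iff Gam_field_rotoreflection)
  have order: "(?A ^^ 6) z = z" for z
    by (simp add: eval_nat_numeral prod_eq_iff vec_eq_iff forall_3)
  have arc: "solves_at phase_domain ?F \<gamma> s {0..2 * \<tau>}" if "s \<in> {0..2 * \<tau>}" for s
    using sol[OF subsetD[OF assms(4) that]] has_vector_derivative_within_subset[OF _ assms(4)]
    unfolding solves_at_def by blast
  have ends: "\<gamma> (2 * \<tau>) = ?A (\<gamma> 0)"
    unfolding assms(6,7) by (simp add: vec_eq_iff forall_3)
  have "2 * \<tau> > 0" using assms(1) by simp
  \<comment> \<open>Here \<open>T = 2 * \<tau>\<close>, and \<open>order\<close> supplies
    \<open>n = 6\<close>.\<close>
  from periodic_extension[OF this _ lin equiv order arc ends]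
  obtain \<delta> where \<delta>: "\<And>s. solves_at phase_domain ?F \<delta> s UNIV"
      "\<And>s. \<delta> (s + real 6 * (2 * \<tau>)) = \<delta> s" "\<delta> 0 = \<gamma> 0"
    by auto
  have "0 \<in> I" using assms(1,4) by auto
  have "\<delta> s = \<gamma> s" if "s \<in> I" for s
  \<comment> \<open>The Lipschitz condition is checked along \<open>\<delta>\<close>, which stays in
    \<open>phase_domain\<close> for all times; the common value is the one at 0.\<close>
  proof (rule ode_unique[where x = \<delta> and y = \<gamma>, OF assms(3) \<open>0 \<in> I\<close> _ _ _ \<delta>(3) that])
    fix s assume "s \<in> I"
    show "lipschitz_near ?F (\<delta> s)" "(\<delta> has_vector_derivative ?F (\<delta> s)) (at s within I)"
      using \<delta>(1)[of s] by (auto simp: solves_at_def intro: lipschitz_near_Gam_field has_vector_derivative_at_within)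
    show "(\<gamma> has_vector_derivative ?F (\<gamma> s)) (at s within I)"
      using sol[OF \<open>s \<in> I\<close>] by (simp add: solves_at_def)
  qed
  moreover have "hamiltonian_solution phase_domain (Gam E) UNIV \<delta>"
    using \<delta>(1) by (simp add: hamiltonian_solution_Gam_iff)
  ultimately show ?thesis using \<delta>(2) by (intro exI[of _ \<delta>]) simp
qed

end
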